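(* Let $n\ge2$, $F=\frac1n\sum_{i=1}^nF_i$ with $F_i:\mathbb{R}^d\to\mathbb{R}^d$, let $b\in\{1,\dots,n\}$, and for $S\subseteq\{1,\dots,n\}$ with $|S|=b$ let $F_S=\frac1b\sum_{i\in S}F_i$. Assume each $F_i$ is $L_i$-Lipschitz and satisfies $\langle F_i(x)-F_i(x^* ),x-x^*\rangle\ge\mu_i\|x-x^*\|^2$ for all $x$ (with possibly negative $\mu_i$). Let $L_S>0$ be the Lipschitz constant of $F_S$ and let $\mu_S\ge\frac1b\sum_{i\in S}\mu_i$, $|\mu_S|\le L_S$, be such that $\langle F_S(x)-F_S(x^* ),x-x^*\rangle\ge\mu_S\|x-x^*\|^2$ for all $x$. Assume $$\overline\mu_{b\text{-}NICE}=\frac{1}{\binom nb}\left(\sum_{|S|=b,\ \mu_S\ge0}\mu_S+4\sum_{|S|=b,\ \mu_S<0}\mu_S\right)>0,$$ and set $L_{b\text{-}NICE}=\max_{|S|=b}L_S$, $\sigma_{US*}^2=\frac1n\sum_{i=1}^n\|F_i(x^* )\|^2$. Let $\xi^k$ be a uniformly random $b$-element subset of $\{1,\dots,n\}$. Let $K\ge0$, $k_0=\lceil K/2\rceil$, and define $\{\beta_k\}_{k\ge0}$ by: $\beta_k=1$ if $K\le\frac{48L_{b\text{-}NICE}}{\overline\mu_{b\text{-}NICE}}$; $\beta_k=1$ if $K>\frac{48L_{b\text{-}NICE}}{\overline\mu_{b\text{-}NICE}}$ and $k<k_0$; $\beta_k=\dfrac{96L_{b\text{-}NICE}}{96L_{b\text{-}NICE}+\overline\mu_{b\text{-}NICE}(k-k_0)}$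 if $K>\frac{48L_{b\text{-}NICE}}{\overline\mu_{b\text{-}NICE}}$ and $k\ge k_0$. Then the iterates of S-SEG with $\gamma_{1,\xi^k}=\frac{\beta_k}{6L_{b\text{-}NICE}}$ and $\gamma_{2,\xi^k}=\frac14\gamma_{1,\xi^k}$ satisfy $$\mathbb{E}\left[\|x^K-x^*\|^2\right]\le\frac{1536L_{b\text{-}NICE}\|x^0-x^*\|^2}{\overline\mu_{b\text{-}NICE}}\exp\left(-\frac{\overline\mu_{b\text{-}NICE}K}{96L_{b\text{-}NICE}}\right)+\frac{1728(n-b)\sigma_{US*}^2}{b(n-1)\overline\mu_{b\text{-}NICE}^2K}.$$
   Context: $x^*\in\mathbb{R}^d$ satisfies $F(x^* )=0$, $\|\cdot\|$ is the Euclidean norm. Sums and maxima over $|S|=b$ range over subsets $S\subseteq\{1,\dots,n\}$ of size $b$. The samples $\xi^0,\xi^1,\dots$ are independent. Same-sample stochastic extragradient (S-SEG), started at a deterministic $x^0$, is $x^{k+1}=x^k-\gamma_{2,\xi^k}F_{\xi^k}(x^k-\gamma_{1,\xi^k}F_{\xi^k}(x^k))$, $k\ge0$. *)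

theory Defs
  imports "HOL-Probability.Probability"
begin

definition batches :: "nat \<Rightarrow> nat \<Rightarrow> nat set set" where
  "batches n b = {S. S \<subseteq> {1..n} \<and> card S = b}"

text \<open>The minibatch operator \<open>F_S\<close>; the full operator \<open>F\<close> is the batch \<open>S = {1..n}\<close>.\<close>

definition batch_op :: "(nat \<Rightarrow> 'a \<Rightarrow> 'a) \<Rightarrow> nat set \<Rightarrow> 'a \<Rightarrow> 'a::real_vector" where
  "batch_op F S x = (1 / real (card S)) *\<^sub>R (\<Sum>i\<in>S. F i x)"

definition mu_bar_NICE :: "nat \<Rightarrow> nat \<Rightarrow> (nat set \<Rightarrow> real) \<Rightarrow> real" where
  "mu_bar_NICE n b muS =
     (1 / real (n choose b)) *
       ((\<Sum>S | S \<in> batches n b \<and> muS S \<ge> 0. muS S) + 4 * (\<Sum>S | S \<in> batches n b \<and> muS S < 0. muS S))"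

definition L_NICE :: "nat \<Rightarrow> nat \<Rightarrow> (nat set \<Rightarrow> real) \<Rightarrow> real" where
  "L_NICE n b LS = Max (LS ` batches n b)"

definition sigma2_US :: "nat \<Rightarrow> (nat \<Rightarrow> 'a \<Rightarrow> 'a::real_normed_vector) \<Rightarrow> 'a \<Rightarrow> real" where
  "sigma2_US n F xs = (1 / real n) * (\<Sum>i=1..n. (norm (F i xs))\<^sup>2)"

definition sseg_beta :: "real \<Rightarrow> real \<Rightarrow> nat \<Rightarrow> nat \<Rightarrow> real" where
  "sseg_beta L mu K k =
     (let k0 = nat \<lceil>real K / 2\<rceil> in
      if real K \<le> 48 * L / mu then 1
      else if k < k0 then 1
      else 96 * L / (96 * L + mu * (real k - real k0)))"

text \<open>Same-sample extragradient along a fixed sample sequence \<open>s\<close>; both stepsizes may depend on the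
  iteration number and on the current sample.\<close>

primrec S_SEG ::
  "('s \<Rightarrow> 'a \<Rightarrow> 'a) \<Rightarrow> (nat \<Rightarrow> 's \<Rightarrow> real) \<Rightarrow> (nat \<Rightarrow> 's \<Rightarrow> real) \<Rightarrow> 'a \<Rightarrow> (nat \<Rightarrow> 's) \<Rightarrow> nat \<Rightarrow> 'a::real_vector"
where
  "S_SEG G g1 g2 x0 s 0 = x0"
| "S_SEG G g1 g2 x0 s (Suc k) =
     (let x = S_SEG G g1 g2 x0 s k
      in x - g2 k (s k) *\<^sub>R G (s k) (x - g1 k (s k) *\<^sub>R G (s k) x))"

end

theory Submission
  imports Defs
begin

text \<open>Write \<open>z\<close> for the root, \<open>\<gamma> = \<beta>\<^sub>k / (6 Lm)\<close> for the extrapolation step, \<open>G\<close> for the operator of the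
sampled batch and \<open>y = x - \<gamma> G x\<close> for the extrapolated point. Using the same sample twice pays off
through the splitting

\<open>G y \<bullet> (x - z) = (G y - G z) \<bullet> (y - z) + G z \<bullet> (x - z) + \<gamma> ((G y - G z) \<bullet> G x)\<close>.

The first term is bounded below by monotonicity around \<open>z\<close>, evaluated at \<open>y\<close>. Passing from \<open>y - z\<close> back
to \<open>x - z\<close> halves a nonnegative modulus and doubles a negative one; this ratio of four is the
weight of the negative moduli in \<^const>\<open>mu_bar_NICE\<close>. The second term is linear in \<open>G z\<close> with a coefficient
independent of the batch, so it averages to zero over the batches although \<open>y\<close> depends on the batch.
In the third term, Lipschitz continuity makes \<open>G y \<bullet> G x\<close> comparable with the squared norm of \<open>G x\<close>,
which absorbs all other second-order terms except a multiple of the noise \<open>\<gamma>\<^sup>2 (norm (G z))\<^sup>2\<close>. This is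
lemma \<open>extragradient_step\<close>.

Averaging over the batches gives a contraction by \<open>1 - \<gamma> mb / 4\<close> plus \<open>3/4 \<gamma>\<^sup>2 V\<close>, where \<open>V\<close> is the
variance of a mean sampled without replacement; counting batches evaluates it
(\<open>batch_op_variance\<close>). The current sample is independent of the current iterate, so the same
inequality holds for the expected squared distances (\<open>expected_S_SEG_step\<close>); giving away half of
the contraction, it becomes

\<open>r (k + 1) \<le> (1 - a \<beta>\<^sub>k) r k + c \<beta>\<^sub>k\<^sup>2\<close> with \<open>a = mb / (48 Lm)\<close> and \<open>c = V / (48 Lm\<^sup>2)\<close>.

The rest is a numerical fact about this recursion (\<open>sseg_beta_recursion\<close>): the constant steps in the
first half shrink the initial error exponentially down to a noise floor \<open>c / a\<close>, and the
decreasing steps \<open>2 / (2 + a j)\<close> in the second half lower this floor to order \<open>c / (a\<^sup>2 K)\<close>.\<close>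

section \<open>One extragradient step for a single operator\<close>

definition eff_mu :: "real \<Rightarrow> real" where
  "eff_mu m = (if m \<ge> 0 then m else 4 * m)"

text \<open>The two signs of \<open>m\<close> use opposite comparisons of \<open>norm (d - e)\<close> with \<open>norm d\<close>: one loses a factor
\<open>1/2\<close>, the other a factor \<open>2\<close>. The definition of \<^const>\<open>eff_mu\<close> makes both losses equal to a
factor \<open>1/2\<close> in front of \<open>eff_mu m\<close>.\<close>

lemma eff_mu_norm_diff:
  fixes d e :: "'a::real_inner"
  shows "m * (norm (d - e))\<^sup>2 \<ge> eff_mu m / 2 * (norm d)\<^sup>2 - 2 * \<bar>m\<bar> * (norm e)\<^sup>2"
proof -
  have lo: "(norm (d - e))\<^sup>2 \<ge> (norm d)\<^sup>2 / 2 - (norm e)\<^sup>2"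
    using zero_le_power2[of "norm (d - 2 *\<^sub>R e)"]
    by (simp add: power2_norm_eq_inner inner_diff algebra_simps inner_commute)
  have hi: "(norm (d - e))\<^sup>2 \<le> 2 * (norm d)\<^sup>2 + 2 * (norm e)\<^sup>2"
    using zero_le_power2[of "norm (d + e)"]
    by (simp add: power2_norm_eq_inner inner_diff inner_add algebra_simps inner_commute)
  show ?thesis
  proof (cases "m \<ge> 0")
    case True
    have "m * (norm (d - e))\<^sup>2 \<ge> m * ((norm d)\<^sup>2 / 2 - (norm e)\<^sup>2)"
      by (rule mult_left_mono[OF lo True])
    also have "m * ((norm d)\<^sup>2 / 2 - (norm e)\<^sup>2) = eff_mu m / 2 * (norm d)\<^sup>2 - 1 * (\<bar>m\<bar> * (norm e)\<^sup>2)"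
      using True by (simp add: eff_mu_def algebra_simps)
    also have "\<dots> \<ge> eff_mu m / 2 * (norm d)\<^sup>2 - 2 * (\<bar>m\<bar> * (norm e)\<^sup>2)"
      by (intro diff_left_mono mult_right_mono) auto
    finally show ?thesis by simp
  next
    case False
    then have "m * (norm (d - e))\<^sup>2 \<ge> m * (2 * (norm d)\<^sup>2 + 2 * (norm e)\<^sup>2)"
      by (intro mult_left_mono_neg[OF hi]) simp
    then show ?thesis using False by (simp add: eff_mu_def algebra_simps)
  qed
qed

text \<open>The term \<open>G z \<bullet> (x - z)\<close> is deliberately left unestimated: it is the only term of first order in the
noise \<open>G z\<close>, and it vanishes when averaged over operators whose mean is zero at \<open>z\<close>. The bound
\<open>\<gamma> * L \<le> 1 / 6\<close> keeps \<open>G\<close> nearly constant along the extrapolation and also makes the loss of order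
\<open>\<gamma>\<^sup>3 \<bar>m\<bar>\<close>, from monotonicity at the extrapolated point instead of \<open>x\<close>, part of the term of order \<open>\<gamma>\<^sup>2\<close>.\<close>

lemma extragradient_step:
  fixes G :: "'a::real_inner \<Rightarrow> 'a"
  assumes lip: "L-lipschitz_on UNIV G"
    and mono: "\<And>y. (G y - G z) \<bullet> (y - z) \<ge> m * (norm (y - z))\<^sup>2"
    and m: "\<bar>m\<bar> \<le> L" and \<gamma>: "0 \<le> \<gamma>" "\<gamma> * L \<le> 1 / 6"
  shows "(norm (x - (\<gamma> / 4) *\<^sub>R G (x - \<gamma> *\<^sub>R G x) - z))\<^sup>2
    \<le> (1 - \<gamma> / 4 * eff_mu m) * (norm (x - z))\<^sup>2 - \<gamma> / 2 * (G z \<bullet> (x - z))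
      + 3 / 4 * \<gamma>\<^sup>2 * (norm (G z))\<^sup>2"
proof -
  define d g h p where "d = x - z" and "g = G x" and "h = G z" and "p = G (x - \<gamma> *\<^sub>R g)"
  have "norm (p - g) \<le> L * norm (x - \<gamma> *\<^sub>R g - x)"
    unfolding p_def g_def using lipschitz_onD[OF lip] by (metis UNIV_I dist_norm)
  also have "\<dots> = (\<gamma> * L) * norm g" using \<gamma> by simp
  also have "\<dots> \<le> 1 / 6 * norm g" by (rule mult_right_mono[OF \<gamma>(2)]) simp
  finally have "(norm (p - g))\<^sup>2 \<le> (1 / 6 * norm g)\<^sup>2" by (rule power_mono) simp
  then have pg: "(norm (p - g))\<^sup>2 \<le> (norm g)\<^sup>2 / 36" by (simp add: power2_eq_square)
  have "(norm g)\<^sup>2 \<le> 2 * (norm p)\<^sup>2 + 2 * (norm (p - g))\<^sup>2"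
    using zero_le_power2[of "norm (2 *\<^sub>R p - g)"]
    by (simp add: power2_norm_eq_inner inner_diff algebra_simps inner_commute)
  with pg have gp: "(norm g)\<^sup>2 / 36 \<le> 3 / 4 * (norm p)\<^sup>2" using zero_le_power2[of "norm p"] by linarith
  \<comment> \<open>Young's inequality; its weight decides the noise coefficient \<open>3/4\<close> of the claim.\<close>
  have hg: "2 * (h \<bullet> g) \<le> (norm g)\<^sup>2 / 3 + 3 * (norm h)\<^sup>2"
    using zero_le_power2[of "norm (g - 3 *\<^sub>R h)"]
    by (simp add: power2_norm_eq_inner inner_diff algebra_simps inner_commute)
  have pgeq: "2 * (p \<bullet> g) = (norm p)\<^sup>2 + (norm g)\<^sup>2 - (norm (p - g))\<^sup>2"
    by (simp add: power2_norm_eq_inner inner_diff algebra_simps inner_commute)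
  have "m * (norm (d - \<gamma> *\<^sub>R g))\<^sup>2 \<le> (p - h) \<bullet> (d - \<gamma> *\<^sub>R g)"
    using mono[of "x - \<gamma> *\<^sub>R g"] by (simp add: p_def h_def d_def algebra_simps)
  with eff_mu_norm_diff[of m d "\<gamma> *\<^sub>R g"]
  have "(p - h) \<bullet> (d - \<gamma> *\<^sub>R g) \<ge> eff_mu m / 2 * (norm d)\<^sup>2 - 2 * \<bar>m\<bar> * (\<gamma>\<^sup>2 * (norm g)\<^sup>2)"
    by (simp add: power_mult_distrib)
  then have "\<gamma> / 2 * ((p - h) \<bullet> (d - \<gamma> *\<^sub>R g))
      \<ge> \<gamma> / 2 * (eff_mu m / 2 * (norm d)\<^sup>2 - 2 * \<bar>m\<bar> * (\<gamma>\<^sup>2 * (norm g)\<^sup>2))"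
    using \<gamma>(1) by (intro mult_left_mono) auto
  moreover have "(\<gamma> * \<bar>m\<bar>) * (\<gamma>\<^sup>2 * (norm g)\<^sup>2) \<le> 1 / 6 * (\<gamma>\<^sup>2 * (norm g)\<^sup>2)"
    using order_trans[OF mult_left_mono[OF m \<gamma>(1)] \<gamma>(2)] by (intro mult_right_mono) auto
  ultimately have mon: "\<gamma> / 2 * ((p - h) \<bullet> (d - \<gamma> *\<^sub>R g))
      \<ge> \<gamma> / 4 * eff_mu m * (norm d)\<^sup>2 - \<gamma>\<^sup>2 / 6 * (norm g)\<^sup>2"
    by (simp add: algebra_simps)
  \<comment> \<open>The part \<open>2/3\<close> of \<open>(norm g)\<^sup>2\<close> is reserved for the loss in \<open>mon\<close>. After polarising \<open>p \<bullet> g\<close> and using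
    \<open>pg\<close> and \<open>hg\<close>, the coefficient of \<open>(norm g)\<^sup>2\<close> is \<open>1/36 - 1 + 1/3 + 2/3 = 1/36\<close>, which the
    remaining \<open>- 3/4 (norm p)\<^sup>2\<close> pays for by \<open>gp\<close>.\<close>
  have "\<gamma>\<^sup>2 / 4 * (- 2 * ((p - h) \<bullet> g) + (norm p)\<^sup>2 / 4 + 2 / 3 * (norm g)\<^sup>2)
      \<le> \<gamma>\<^sup>2 / 4 * (3 * (norm h)\<^sup>2)"
    using pg gp hg pgeq by (intro mult_left_mono) (auto simp: inner_diff_left)
  then have "- \<gamma>\<^sup>2 / 2 * ((p - h) \<bullet> g) + \<gamma>\<^sup>2 / 16 * (norm p)\<^sup>2 + \<gamma>\<^sup>2 / 6 * (norm g)\<^sup>2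
      \<le> 3 / 4 * \<gamma>\<^sup>2 * (norm h)\<^sup>2"
    by (simp add: distrib_left right_diff_distrib)
  moreover have "(norm (d - (\<gamma> / 4) *\<^sub>R p))\<^sup>2 = (norm d)\<^sup>2 - \<gamma> / 2 * ((p - h) \<bullet> (d - \<gamma> *\<^sub>R g))
      - \<gamma> / 2 * (h \<bullet> d) - \<gamma>\<^sup>2 / 2 * ((p - h) \<bullet> g) + \<gamma>\<^sup>2 / 16 * (norm p)\<^sup>2"
    unfolding power2_norm_eq_inner
    by (simp add: inner_diff algebra_simps inner_commute power2_eq_square diff_divide_distrib)
  ultimately have "(norm (d - (\<gamma> / 4) *\<^sub>R p))\<^sup>2
      \<le> (1 - \<gamma> / 4 * eff_mu m) * (norm d)\<^sup>2 - \<gamma> / 2 * (h \<bullet> d) + 3 / 4 * \<gamma>\<^sup>2 * (norm h)\<^sup>2"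
    using mon left_diff_distrib[of 1 "\<gamma> / 4 * eff_mu m" "(norm d)\<^sup>2"] by linarith
  moreover have "x - (\<gamma> / 4) *\<^sub>R G (x - \<gamma> *\<^sub>R G x) - z = d - (\<gamma> / 4) *\<^sub>R p"
    by (simp add: d_def p_def g_def algebra_simps)
  ultimately show ?thesis by (simp only: d_def h_def)
qed

lemma averaged_extragradient_step:
  fixes G :: "'s \<Rightarrow> 'a::real_inner \<Rightarrow> 'a"
  assumes B: "finite B" "B \<noteq> {}"
    and lip: "\<And>S. S \<in> B \<Longrightarrow> L-lipschitz_on UNIV (G S)"
    and mono: "\<And>S y. S \<in> B \<Longrightarrow> (G S y - G S z) \<bullet> (y - z) \<ge> m S * (norm (y - z))\<^sup>2"
    and m: "\<And>S. S \<in> B \<Longrightarrow> \<bar>m S\<bar> \<le> L"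
    and \<gamma>: "0 \<le> \<gamma>" "\<gamma> * L \<le> 1 / 6"
    and root: "(\<Sum>S\<in>B. G S z) = 0"
  shows "(\<Sum>S\<in>B. (norm (x - (\<gamma> / 4) *\<^sub>R G S (x - \<gamma> *\<^sub>R G S x) - z))\<^sup>2) / real (card B)
    \<le> (1 - \<gamma> / 4 * ((\<Sum>S\<in>B. eff_mu (m S)) / real (card B))) * (norm (x - z))\<^sup>2
      + 3 / 4 * \<gamma>\<^sup>2 * ((\<Sum>S\<in>B. (norm (G S z))\<^sup>2) / real (card B))"
proof -
  have pos: "real (card B) > 0" using B by (simp add: card_gt_0_iff)
  have "(\<Sum>S\<in>B. (norm (x - (\<gamma> / 4) *\<^sub>R G S (x - \<gamma> *\<^sub>R G S x) - z))\<^sup>2)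
      \<le> (\<Sum>S\<in>B. (1 - \<gamma> / 4 * eff_mu (m S)) * (norm (x - z))\<^sup>2 - \<gamma> / 2 * (G S z \<bullet> (x - z))
          + 3 / 4 * \<gamma>\<^sup>2 * (norm (G S z))\<^sup>2)"
    by (intro sum_mono extragradient_step[OF lip mono m \<gamma>]) auto
  also have "\<dots> = (real (card B) - \<gamma> / 4 * (\<Sum>S\<in>B. eff_mu (m S))) * (norm (x - z))\<^sup>2
      - \<gamma> / 2 * ((\<Sum>S\<in>B. G S z) \<bullet> (x - z)) + 3 / 4 * \<gamma>\<^sup>2 * (\<Sum>S\<in>B. (norm (G S z))\<^sup>2)"
    by (simp add: sum.distrib sum_subtractf sum_distrib_left sum_distrib_right inner_sum_left
        left_diff_distrib mult.assoc)
  finally show ?thesis using pos by (simp add: root field_simps)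
qed

section \<open>Mean and variance of a batch sampled without replacement\<close>

lemma card_subsets_between:
  assumes A: "finite A" and IJ: "I \<subseteq> A" "J \<subseteq> A" "I \<inter> J = {}"
  shows "card {S. I \<subseteq> S \<and> S \<subseteq> A - J \<and> card S = card I + m}
    = (card A - card I - card J) choose m"
proof -
  have fin: "finite I" "finite J" using A IJ by (auto intro: finite_subset)
  have "bij_betw (\<lambda>T. I \<union> T) {T. T \<subseteq> A - (I \<union> J) \<and> card T = m}
      {S. I \<subseteq> S \<and> S \<subseteq> A - J \<and> card S = card I + m}"
  proof (rule bij_betw_byWitness[where f' = "\<lambda>S. S - I"])
    show "(\<lambda>T. I \<union> T) ` {T. T \<subseteq> A - (I \<union> J) \<and> card T = m}
        \<subseteq> {S. I \<subseteq> S \<and> S \<subseteq> A - J \<and> card S = card I + m}"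
    proof clarsimp
      fix T assume T: "T \<subseteq> A - (I \<union> J)"
      then have "finite T" "I \<inter> T = {}" using A by (auto intro: finite_subset)
      with T show "I \<subseteq> A - J \<and> T \<subseteq> A - J \<and> card (I \<union> T) = card I + card T"
        using IJ fin by (auto simp: card_Un_disjoint)
    qed
    show "(\<lambda>S. S - I) ` {S. I \<subseteq> S \<and> S \<subseteq> A - J \<and> card S = card I + m}
        \<subseteq> {T. T \<subseteq> A - (I \<union> J) \<and> card T = m}"
      using fin by (auto simp: card_Diff_subset)
  qed auto
  then have "card {S. I \<subseteq> S \<and> S \<subseteq> A - J \<and> card S = card I + m}
      = card {T. T \<subseteq> A - (I \<union> J) \<and> card T = m}"
    by (simp add: bij_betw_same_card)
  also have "\<dots> = card (A - (I \<union> J)) choose m" using A by (intro n_subsets) auto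
  also have "card (A - (I \<union> J)) = card A - card I - card J"
    using A IJ fin by (simp add: card_Diff_subset card_Un_disjoint)
  finally show ?thesis .
qed

lemma finite_batches [simp]: "finite (batches n b)"
  by (rule finite_subset[of _ "Pow {1..n}"]) (auto simp: batches_def)

lemma card_batches: "card (batches n b) = n choose b"
  using n_subsets[of "{1..n}" b] by (simp add: batches_def)

lemma card_batches_pos: "b \<le> n \<Longrightarrow> 0 < card (batches n b)"
  by (simp add: card_batches)

text \<open>Each index lies in the same number of batches: the rest of the batch is any choice among the other indices.\<close>

lemma sum_batches_sum:
  fixes v :: "nat \<Rightarrow> 'a::real_vector"
  assumes b: "1 \<le> b"
  shows "(\<Sum>S\<in>batches n b. \<Sum>i\<in>S. v i) = real ((n - 1) choose (b - 1)) *\<^sub>R (\<Sum>i=1..n. v i)"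
proof -
  have cnt: "card {S \<in> batches n b. i \<in> S} = (n - 1) choose (b - 1)" if "i \<in> {1..n}" for i
  proof -
    have "{S \<in> batches n b. i \<in> S} = {S. {i} \<subseteq> S \<and> S \<subseteq> {1..n} - {} \<and> card S = card {i} + (b - 1)}"
      using b by (auto simp: batches_def)
    then show ?thesis using card_subsets_between[of "{1..n}" "{i}" "{}" "b - 1"] that by simp
  qed
  have "(\<Sum>S\<in>batches n b. \<Sum>i\<in>S. v i) = (\<Sum>S\<in>batches n b. \<Sum>i | i \<in> {1..n} \<and> i \<in> S. v i)"
    by (intro sum.cong refl) (auto simp: batches_def)
  also have "\<dots> = (\<Sum>i=1..n. \<Sum>S | S \<in> batches n b \<and> i \<in> S. v i)"
    by (rule sum.swap_restrict) auto
  also have "\<dots> = (\<Sum>i=1..n. real ((n - 1) choose (b - 1)) *\<^sub>R v i)"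
    using cnt by (intro sum.cong refl) (simp add: scaleR_conv_of_real sum_constant_scaleR)
  finally show ?thesis by (simp add: scaleR_sum_right)
qed

text \<open>Since the \<open>v i\<close> sum to zero, the sum over a batch is minus the sum over its complement, so its squared norm
is a sum of \<open>- (v i \<bullet> v j)\<close> over pairs with \<open>i \<in> S\<close> and \<open>j \<notin> S\<close>. Every ordered pair of distinct indices is
separated in this way by the same number of batches; summing over \<open>j\<close> first then turns
\<open>- (\<Sum>j\<noteq>i. v j)\<close> back into \<open>v i\<close>.\<close>

lemma sum_batches_norm_sum:
  fixes v :: "nat \<Rightarrow> 'a::real_inner"
  assumes b: "1 \<le> b" and v: "(\<Sum>i=1..n. v i) = 0"
  shows "(\<Sum>S\<in>batches n b. (norm (\<Sum>i\<in>S. v i))\<^sup>2)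
    = real ((n - 2) choose (b - 1)) * (\<Sum>i=1..n. (norm (v i))\<^sup>2)"
proof -
  let ?A = "{1..n}"
  have cnt: "card {S \<in> batches n b. i \<in> S \<and> j \<notin> S} = (n - 2) choose (b - 1)"
    if "i \<in> ?A" "j \<in> ?A - {i}" for i j
  proof -
    have "{S \<in> batches n b. i \<in> S \<and> j \<notin> S}
        = {S. {i} \<subseteq> S \<and> S \<subseteq> ?A - {j} \<and> card S = card {i} + (b - 1)}"
      using b by (auto simp: batches_def)
    then show ?thesis
      using card_subsets_between[of ?A "{i}" "{j}" "b - 1"] that by (simp add: numeral_2_eq_2)
  qed
  have "(norm (\<Sum>i\<in>S. v i))\<^sup>2 = (\<Sum>i\<in>?A. \<Sum>j\<in>?A - {i}. if i \<in> S \<and> j \<notin> S then - (v i \<bullet> v j) else 0)"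
    if S: "S \<in> batches n b" for S
  proof -
    have SA: "S \<subseteq> ?A" using S by (simp add: batches_def)
    have "(\<Sum>i\<in>S. v i) = - (\<Sum>j\<in>?A - S. v j)"
      using v sum.subset_diff[OF SA, of v] by (simp add: eq_neg_iff_add_eq_0 add.commute)
    then have "(norm (\<Sum>i\<in>S. v i))\<^sup>2 = (\<Sum>i\<in>S. v i) \<bullet> (- (\<Sum>j\<in>?A - S. v j))"
      by (metis power2_norm_eq_inner)
    also have "\<dots> = (\<Sum>i\<in>S. \<Sum>j\<in>?A - S. - (v i \<bullet> v j))"
      by (simp add: inner_sum_left, simp add: inner_sum_right sum_negf)
    also have "\<dots> = (\<Sum>i\<in>?A. if i \<in> S then \<Sum>j\<in>?A - S. - (v i \<bullet> v j) else 0)"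
      using SA by (simp add: sum.inter_restrict[symmetric] Int_absorb1)
    also have "\<dots> = (\<Sum>i\<in>?A. \<Sum>j\<in>?A - {i}. if i \<in> S \<and> j \<notin> S then - (v i \<bullet> v j) else 0)"
    proof (intro sum.cong refl)
      fix i
      show "(if i \<in> S then \<Sum>j\<in>?A - S. - (v i \<bullet> v j) else 0)
          = (\<Sum>j\<in>?A - {i}. if i \<in> S \<and> j \<notin> S then - (v i \<bullet> v j) else 0)"
      proof (cases "i \<in> S")
        case True
        then have "?A - S = {j \<in> ?A - {i}. j \<notin> S}" by auto
        then show ?thesis using True by (simp add: sum.inter_filter[symmetric])
      qed simp
    qed
    finally show ?thesis .
  qed
  then have "(\<Sum>S\<in>batches n b. (norm (\<Sum>i\<in>S. v i))\<^sup>2)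
      = (\<Sum>S\<in>batches n b. \<Sum>i\<in>?A. \<Sum>j\<in>?A - {i}. if i \<in> S \<and> j \<notin> S then - (v i \<bullet> v j) else 0)"
    by (intro sum.cong refl)
  also have "\<dots> = (\<Sum>i\<in>?A. \<Sum>j\<in>?A - {i}. \<Sum>S\<in>batches n b. if i \<in> S \<and> j \<notin> S then - (v i \<bullet> v j) else 0)"
    by (subst sum.swap, intro sum.cong refl, rule sum.swap)
  also have "\<dots> = (\<Sum>i\<in>?A. \<Sum>j\<in>?A - {i}. real ((n - 2) choose (b - 1)) * - (v i \<bullet> v j))"
    by (intro sum.cong refl) (simp add: sum.inter_filter[symmetric] cnt)
  also have "\<dots> = real ((n - 2) choose (b - 1)) * (\<Sum>i\<in>?A. v i \<bullet> (- (\<Sum>j\<in>?A - {i}. v j)))"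
    by (simp add: sum_distrib_left inner_sum_right sum_negf)
  also have "(\<Sum>i\<in>?A. v i \<bullet> (- (\<Sum>j\<in>?A - {i}. v j))) = (\<Sum>i\<in>?A. (norm (v i))\<^sup>2)"
  proof (intro sum.cong refl)
    fix i assume "i \<in> ?A"
    then have "- (\<Sum>j\<in>?A - {i}. v j) = v i" using v by (simp add: sum_diff1)
    then show "v i \<bullet> (- (\<Sum>j\<in>?A - {i}. v j)) = (norm (v i))\<^sup>2" by (simp add: power2_norm_eq_inner)
  qed
  finally show ?thesis .
qed

lemma choose_split_ratio:
  assumes "n \<ge> 2" "1 \<le> b" "b \<le> n"
  shows "real n * (real n - 1) * real ((n - 2) choose (b - 1))
    = real b * (real n - real b) * real (n choose b)"
proof (cases "b = n")
  case True
  then show ?thesis using assms by simp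
next
  case False
  obtain m c where mc: "n = Suc (Suc m)" "b = Suc c"
    using assms that[of "n - 2" "b - 1"] by simp
  have c: "c \<le> m" using False assms mc by simp
  have 1: "real (Suc c) * real (Suc (Suc m) choose Suc c) = real (Suc (Suc m)) * real (Suc m choose c)"
    using Suc_times_binomial[of c "Suc m"] by (metis of_nat_mult)
  have "(Suc m - c) * (Suc m choose c) = Suc m * (m choose c)"
    using binomial_absorb_comp[of "Suc m" c] by simp
  then have "real (Suc m - c) * real (Suc m choose c) = real (Suc m) * real (m choose c)"
    by (metis of_nat_mult)
  then have 2: "(real (Suc m) - real c) * real (Suc m choose c) = real (Suc m) * real (m choose c)"
    using c by (simp add: of_nat_diff)
  have "real (Suc (Suc m)) * (real (Suc (Suc m)) - 1) * real (m choose c)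
      = real (Suc (Suc m)) * ((real (Suc m) - real c) * real (Suc m choose c))"
    unfolding 2 by simp
  also have "\<dots> = (real (Suc m) - real c) * (real (Suc c) * real (Suc (Suc m) choose Suc c))"
    unfolding 1 by simp
  finally show ?thesis by (simp add: mc algebra_simps)
qed

lemma batch_op_mean_zero:
  assumes "1 \<le> b" "batch_op F {1..n} z = 0" "n \<ge> 1"
  shows "(\<Sum>S\<in>batches n b. batch_op F S z) = 0"
proof -
  have "(\<Sum>i=1..n. F i z) = 0" using assms by (simp add: batch_op_def)
  moreover have "(\<Sum>S\<in>batches n b. batch_op F S z)
      = (\<Sum>S\<in>batches n b. (1 / real b) *\<^sub>R (\<Sum>i\<in>S. F i z))"
    by (intro sum.cong refl) (simp add: batch_op_def batches_def)
  ultimately show ?thesis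
    using sum_batches_sum[OF assms(1), of "\<lambda>i. F i z" n] by (simp add: scaleR_sum_right[symmetric])
qed

text \<open>The factor \<open>(n - b) / (b (n - 1))\<close> is the finite population correction of sampling without
replacement; it is the ratio of \<open>(n - 2) choose (b - 1)\<close>, the number of batches separating two
indices, to the number of all batches, after normalisation.\<close>

lemma batch_op_variance:
  fixes F :: "nat \<Rightarrow> 'a \<Rightarrow> 'a::real_inner"
  assumes n: "n \<ge> 2" and b: "1 \<le> b" "b \<le> n" and root: "batch_op F {1..n} z = 0"
  shows "(\<Sum>S\<in>batches n b. (norm (batch_op F S z))\<^sup>2) / real (card (batches n b))
    = (real n - real b) * sigma2_US n F z / (real b * (real n - 1))"
proof -
  define Q where "Q = (\<Sum>i=1..n. (norm (F i z))\<^sup>2)"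
  define C where "C = real (n choose b)"
  have C: "C > 0" using b by (simp add: C_def)
  have zero: "(\<Sum>i=1..n. F i z) = 0" using root n by (simp add: batch_op_def)
  have "(\<Sum>S\<in>batches n b. (norm (batch_op F S z))\<^sup>2)
      = (\<Sum>S\<in>batches n b. (norm (\<Sum>i\<in>S. F i z))\<^sup>2 / (real b)\<^sup>2)"
    by (intro sum.cong refl) (auto simp: batch_op_def batches_def power_divide)
  also have "\<dots> = real ((n - 2) choose (b - 1)) * Q / (real b)\<^sup>2"
    using sum_batches_norm_sum[OF b(1) zero] by (simp add: sum_divide_distrib[symmetric] Q_def)
  also have "real ((n - 2) choose (b - 1)) = real b * (real n - real b) * C / (real n * (real n - 1))"
    using choose_split_ratio[OF n b] n by (simp add: field_simps C_def)
  finally have "(\<Sum>S\<in>batches n b. (norm (batch_op F S z))\<^sup>2)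
      = (real b * (real n - real b) * C / (real n * (real n - 1))) * Q / (real b)\<^sup>2" .
  then show ?thesis using C n b
    unfolding card_batches C_def[symmetric] sigma2_US_def Q_def[symmetric]
    by (simp add: power2_eq_square)
qed

lemma mu_bar_NICE_eq_mean:
  "mu_bar_NICE n b muS = (\<Sum>S\<in>batches n b. eff_mu (muS S)) / real (card (batches n b))"
proof -
  have "(\<Sum>S\<in>batches n b. eff_mu (muS S))
      = sum muS (batches n b \<inter> {S. muS S \<ge> 0}) + (\<Sum>S\<in>batches n b \<inter> - {S. muS S \<ge> 0}. 4 * muS S)"
    unfolding eff_mu_def by (rule sum.If_cases) simp
  also have "batches n b \<inter> {S. muS S \<ge> 0} = {S. S \<in> batches n b \<and> muS S \<ge> 0}" by auto
  also have "batches n b \<inter> - {S. muS S \<ge> 0} = {S. S \<in> batches n b \<and> muS S < 0}" by auto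
  finally show ?thesis
    unfolding mu_bar_NICE_def card_batches by (simp add: sum_distrib_left)
qed

section \<open>From batch averages to expectations along the iteration\<close>

text \<open>Conditioning on the past without conditional expectations: the sample takes finitely many values, so
the integrand is a finite sum of products of a function of the past and the indicator of one value
of the fresh sample, and independence factorises each product. As the past has only finitely many
values too, measurability and integrability hold for every function \<open>\<phi>\<close>.\<close>

lemma (in prob_space) expectation_fresh_uniform_sample:
  fixes \<xi> :: "nat \<Rightarrow> 'a \<Rightarrow> 's" and \<phi> :: "(nat \<Rightarrow> 's) \<Rightarrow> 's \<Rightarrow> real"
  assumes B: "finite B"
    and indep: "indep_vars (\<lambda>k. count_space B) \<xi> UNIV"
    and unif: "distr M (count_space B) (\<xi> k) = uniform_count_measure B"
  defines "P \<equiv> \<lambda>\<omega>. restrict (\<lambda>i. \<xi> i \<omega>) {..<k}"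
  shows "integrable M (\<lambda>\<omega>. \<phi> (P \<omega>) S)"
    and "expectation (\<lambda>\<omega>. \<phi> (P \<omega>) (\<xi> k \<omega>)) = expectation (\<lambda>\<omega>. (\<Sum>S\<in>B. \<phi> (P \<omega>) S) / real (card B))"
proof -
  have rv: "\<xi> i \<in> measurable M (count_space B)" for i
    using indep by (auto simp: indep_vars_def)
  have PiM: "PiM I (\<lambda>i. count_space B) = count_space (PiE I (\<lambda>i. B))" if "finite I" for I :: "nat set"
    using that B by (intro count_space_PiM_finite) (auto intro: countable_finite)
  have ind: "indep_var (count_space (PiE {..<k} (\<lambda>i. B))) P (count_space (PiE {k} (\<lambda>i. B)))
      (\<lambda>\<omega>. restrict (\<lambda>i. \<xi> i \<omega>) {k})"
    using indep_var_restrict[OF indep, of "{..<k}" "{k}"] by (simp add: PiM P_def)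
  have Pm: "P \<in> measurable M (count_space (PiE {..<k} (\<lambda>i. B)))"
    using indep_var_rv1[OF ind] .
  have finPiE: "finite (PiE {..<k} (\<lambda>i. B))" using B by (intro finite_PiE) auto
  have int: "integrable M (\<lambda>\<omega>. f (P \<omega>))" for f :: "(nat \<Rightarrow> 's) \<Rightarrow> real"
  proof (rule integrable_const_bound)
    show "AE \<omega> in M. norm (f (P \<omega>)) \<le> Max ((\<lambda>p. norm (f p)) ` PiE {..<k} (\<lambda>i. B))"
      using measurable_space[OF Pm] finPiE by (intro AE_I2) auto
    show "(\<lambda>\<omega>. f (P \<omega>)) \<in> borel_measurable M"
      using measurable_compose[OF Pm, of f borel] by simp
  qed
  show "integrable M (\<lambda>\<omega>. \<phi> (P \<omega>) S)" by (rule int)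
  have sp: "\<xi> k \<omega> \<in> B" if "\<omega> \<in> space M" for \<omega>
    using measurable_space[OF rv that] by simp
  have hitm: "(\<lambda>\<omega>. indicator {S} (\<xi> k \<omega>) :: real) \<in> borel_measurable M" for S
    using measurable_compose[OF rv, of "indicator {S}" borel] by simp
  have hit: "integrable M (\<lambda>\<omega>. indicator {S} (\<xi> k \<omega>) :: real)" for S
    by (rule integrable_const_bound[of _ 1, OF AE_I2 hitm]) (simp add: indicator_def)
  have prob: "expectation (\<lambda>\<omega>. indicator {S} (\<xi> k \<omega>)) = 1 / real (card B)" if "S \<in> B" for S
  proof -
    have "expectation (\<lambda>\<omega>. indicator {S} (\<xi> k \<omega>) :: real)
        = (\<integral>T. indicator {S} T \<partial>distr M (count_space B) (\<xi> k))"
      by (subst integral_distr[OF rv]) auto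
    also have "\<dots> = measure (uniform_count_measure B) {S}"
      unfolding unif using that by (simp add: space_uniform_count_measure Int_absorb1)
    finally show ?thesis using B that by (simp add: measure_uniform_count_measure)
  qed
  have split: "expectation (\<lambda>\<omega>. \<phi> (P \<omega>) S * indicator {S} (\<xi> k \<omega>))
      = expectation (\<lambda>\<omega>. \<phi> (P \<omega>) S) * expectation (\<lambda>\<omega>. indicator {S} (\<xi> k \<omega>))"
    and int_split: "integrable M (\<lambda>\<omega>. \<phi> (P \<omega>) S * indicator {S} (\<xi> k \<omega>))" for S
  proof -
    have "indep_var borel ((\<lambda>p. \<phi> p S) \<circ> P) borel
        ((\<lambda>p. indicator {S} (p k)) \<circ> (\<lambda>\<omega>. restrict (\<lambda>i. \<xi> i \<omega>) {k}))"
      by (rule indep_var_compose[OF ind]) auto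
    then have iv: "indep_var borel (\<lambda>\<omega>. \<phi> (P \<omega>) S) borel (\<lambda>\<omega>. indicator {S} (\<xi> k \<omega>) :: real)"
      by (simp add: comp_def)
    show "expectation (\<lambda>\<omega>. \<phi> (P \<omega>) S * indicator {S} (\<xi> k \<omega>))
      = expectation (\<lambda>\<omega>. \<phi> (P \<omega>) S) * expectation (\<lambda>\<omega>. indicator {S} (\<xi> k \<omega>))"
      by (rule indep_var_lebesgue_integral[OF iv int hit])
    show "integrable M (\<lambda>\<omega>. \<phi> (P \<omega>) S * indicator {S} (\<xi> k \<omega>))"
      by (rule indep_var_integrable[OF iv int hit])
  qed
  have "expectation (\<lambda>\<omega>. \<phi> (P \<omega>) (\<xi> k \<omega>))
      = expectation (\<lambda>\<omega>. \<Sum>S\<in>B. \<phi> (P \<omega>) S * indicator {S} (\<xi> k \<omega>))"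
    by (intro Bochner_Integration.integral_cong refl)
       (use B sp in \<open>simp add: indicator_def if_distrib cong: if_cong\<close>)
  also have "\<dots> = (\<Sum>S\<in>B. expectation (\<lambda>\<omega>. \<phi> (P \<omega>) S * indicator {S} (\<xi> k \<omega>)))"
    by (rule Bochner_Integration.integral_sum) (rule int_split)
  also have "\<dots> = (\<Sum>S\<in>B. expectation (\<lambda>\<omega>. \<phi> (P \<omega>) S) / real (card B))"
    by (intro sum.cong refl) (simp add: split prob)
  also have "\<dots> = expectation (\<lambda>\<omega>. (\<Sum>S\<in>B. \<phi> (P \<omega>) S) / real (card B))"
  proof -
    have "expectation (\<lambda>\<omega>. \<Sum>S\<in>B. \<phi> (P \<omega>) S) = (\<Sum>S\<in>B. expectation (\<lambda>\<omega>. \<phi> (P \<omega>) S))"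
      by (rule Bochner_Integration.integral_sum) (rule int)
    then show ?thesis by (simp add: sum_divide_distrib[symmetric])
  qed
  finally show "expectation (\<lambda>\<omega>. \<phi> (P \<omega>) (\<xi> k \<omega>))
      = expectation (\<lambda>\<omega>. (\<Sum>S\<in>B. \<phi> (P \<omega>) S) / real (card B))" .
qed

lemma S_SEG_cong:
  assumes "\<And>i. i < k \<Longrightarrow> s i = s' i"
  shows "S_SEG G g1 g2 x0 s k = S_SEG G g1 g2 x0 s' k"
  using assms by (induction k) (auto simp: Let_def)

text \<open>The iterate with index \<open>k\<close> depends on the samples before \<open>k\<close> only, so sample \<open>k\<close> is fresh and a bound
on the average over \<open>B\<close> from every starting point passes to expectations.\<close>

lemma (in prob_space) expected_S_SEG_step:
  fixes G :: "'s \<Rightarrow> 'v::real_normed_vector \<Rightarrow> 'v" and \<xi> :: "nat \<Rightarrow> 'a \<Rightarrow> 's"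
  assumes B: "finite B"
    and indep: "indep_vars (\<lambda>k. count_space B) \<xi> UNIV"
    and unif: "distr M (count_space B) (\<xi> k) = uniform_count_measure B"
    and mean: "\<And>x. (\<Sum>S\<in>B. (norm (x - g2 k S *\<^sub>R G S (x - g1 k S *\<^sub>R G S x) - z))\<^sup>2) / real (card B)
        \<le> q * (norm (x - z))\<^sup>2 + e"
  shows "expectation (\<lambda>\<omega>. (norm (S_SEG G g1 g2 x0 (\<lambda>i. \<xi> i \<omega>) (Suc k) - z))\<^sup>2)
    \<le> q * expectation (\<lambda>\<omega>. (norm (S_SEG G g1 g2 x0 (\<lambda>i. \<xi> i \<omega>) k - z))\<^sup>2) + e"
proof -
  define P where "P = (\<lambda>\<omega>. restrict (\<lambda>i. \<xi> i \<omega>) {..<k})"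
  define X where "X = (\<lambda>p. S_SEG G g1 g2 x0 p k)"
  define \<phi> where "\<phi> = (\<lambda>p S. (norm (X p - g2 k S *\<^sub>R G S (X p - g1 k S *\<^sub>R G S (X p)) - z))\<^sup>2)"
  have X: "S_SEG G g1 g2 x0 (\<lambda>i. \<xi> i \<omega>) k = X (P \<omega>)" for \<omega>
    unfolding X_def P_def by (rule S_SEG_cong) simp
  note fresh = expectation_fresh_uniform_sample[OF B indep unif]
  have int: "integrable M (\<lambda>\<omega>. f (P \<omega>))" for f :: "(nat \<Rightarrow> 's) \<Rightarrow> real"
    unfolding P_def by (rule fresh(1)[of "\<lambda>p _. f p"])
  have "expectation (\<lambda>\<omega>. (norm (S_SEG G g1 g2 x0 (\<lambda>i. \<xi> i \<omega>) (Suc k) - z))\<^sup>2)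
      = expectation (\<lambda>\<omega>. \<phi> (P \<omega>) (\<xi> k \<omega>))"
    by (simp add: X Let_def \<phi>_def)
  also have "\<dots> = expectation (\<lambda>\<omega>. (\<Sum>S\<in>B. \<phi> (P \<omega>) S) / real (card B))"
    unfolding P_def by (rule fresh(2))
  also have "\<dots> \<le> expectation (\<lambda>\<omega>. q * (norm (X (P \<omega>) - z))\<^sup>2 + e)"
  proof (rule integral_mono)
    show "integrable M (\<lambda>\<omega>. (\<Sum>S\<in>B. \<phi> (P \<omega>) S) / real (card B))" by (rule int)
    show "integrable M (\<lambda>\<omega>. q * (norm (X (P \<omega>) - z))\<^sup>2 + e)" by (rule int)
    show "(\<Sum>S\<in>B. \<phi> (P \<omega>) S) / real (card B) \<le> q * (norm (X (P \<omega>) - z))\<^sup>2 + e" for \<omega>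
      unfolding \<phi>_def by (rule mean)
  qed
  also have "\<dots> = q * expectation (\<lambda>\<omega>. (norm (X (P \<omega>) - z))\<^sup>2) + e"
    using int[of "\<lambda>p. (norm (X p - z))\<^sup>2"] by (simp add: prob_space)
  finally show ?thesis by (simp add: X)
qed

section \<open>The stepsize recursion\<close>

lemma geometric_recursion:
  fixes r :: "nat \<Rightarrow> real"
  assumes "0 < a" "a \<le> 1" "0 \<le> c" "0 \<le> r 0"
    and step: "\<And>k. k < K \<Longrightarrow> r (Suc k) \<le> (1 - a) * r k + c"
  shows "r K \<le> exp (- (a * real K)) * r 0 + c / a"
proof -
  have "k \<le> K \<Longrightarrow> r k \<le> (1 - a) ^ k * r 0 + c / a" for k
  proof (induction k)
    case 0
    then show ?case using assms by simp
  next
    case (Suc k)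
    have "r (Suc k) \<le> (1 - a) * r k + c" using step Suc by simp
    also have "\<dots> \<le> (1 - a) * ((1 - a) ^ k * r 0 + c / a) + c"
      using Suc assms by (intro add_right_mono mult_left_mono) auto
    also have "\<dots> = (1 - a) ^ Suc k * r 0 + c / a" using assms by (simp add: field_simps)
    finally show ?case .
  qed
  then have "r K \<le> (1 - a) ^ K * r 0 + c / a" by simp
  also have "(1 - a) ^ K \<le> exp (- a) ^ K"
    using assms exp_ge_add_one_self[of "- a"] by (intro power_mono) auto
  also have "exp (- a) ^ K = exp (- (a * real K))"
    by (simp add: exp_of_nat_mult[symmetric] mult.commute)
  finally show ?thesis using assms by (simp add: mult_right_mono)
qed

text \<open>The weight \<open>u\<^sup>2\<close> with \<open>u = 2 + a j\<close> cancels the denominator of the squared step, and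
\<open>u\<^sup>2 (1 - 2 a / u) = u (u - 2 a) \<le> (u - a)\<^sup>2\<close> is the weight of the preceding index, so the
weighted quantities telescope.\<close>

lemma decreasing_recursion:
  fixes r :: "nat \<Rightarrow> real"
  assumes a: "0 < a" "a \<le> 1" and r: "\<And>j. 0 \<le> r j"
    and step: "\<And>j. j < J \<Longrightarrow>
      r (Suc j) \<le> (1 - a * (2 / (2 + a * real j))) * r j + c * (2 / (2 + a * real j))\<^sup>2"
  shows "(2 + a * (real J - 1))\<^sup>2 * r J \<le> (2 - a)\<^sup>2 * r 0 + 4 * c * real J"
proof -
  have "j \<le> J \<Longrightarrow> (2 + a * (real j - 1))\<^sup>2 * r j \<le> (2 - a)\<^sup>2 * r 0 + 4 * c * real j" for j
  proof (induction j)
    case 0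
    then show ?case by simp
  next
    case (Suc j)
    define u where "u = 2 + a * real j"
    have u: "u > 0" using a by (simp add: u_def add_pos_nonneg)
    have "u\<^sup>2 * r (Suc j) \<le> u\<^sup>2 * ((1 - a * (2 / u)) * r j + c * (2 / u)\<^sup>2)"
      using step[of j] Suc by (intro mult_left_mono) (auto simp: u_def)
    also have "\<dots> = (u * (u - 2 * a)) * r j + 4 * c"
      using u by (simp add: field_simps power2_eq_square)
    also have "\<dots> \<le> (u - a)\<^sup>2 * r j + 4 * c"
      using r[of j] by (intro add_right_mono mult_right_mono) (auto simp: power2_eq_square algebra_simps)
    also have "(u - a)\<^sup>2 * r j \<le> (2 - a)\<^sup>2 * r 0 + 4 * c * real j"
      using Suc by (simp add: u_def algebra_simps)
    finally show ?case by (simp add: u_def algebra_simps)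
  qed
  then show ?thesis by simp
qed

lemma sseg_beta_bounds:
  assumes "0 < L" "0 < mu"
  shows "0 \<le> sseg_beta L mu K k" "sseg_beta L mu K k \<le> 1"
proof -
  obtain k0 where k0: "sseg_beta L mu K k = (if real K \<le> 48 * L / mu then 1
      else if k < k0 then 1 else 96 * L / (96 * L + mu * (real k - real k0)))"
    unfolding sseg_beta_def Let_def by blast
  have "96 * L / (96 * L + mu * (real k - real k0)) \<in> {0..1}" if "\<not> k < k0"
  proof -
    have "0 \<le> mu * (real k - real k0)" using assms that by simp
    then show ?thesis using assms by simp
  qed
  then show "0 \<le> sseg_beta L mu K k" "sseg_beta L mu K k \<le> 1"
    unfolding k0 by auto
qed

text \<open>In terms of \<open>a\<close>, the stepsizes are constant when \<open>K \<le> 1 / a\<close>; the noise floor \<open>c / a\<close> is then already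
at most \<open>c / (a\<^sup>2 K)\<close>. Otherwise the floor left by the constant phase is at most \<open>c K\<close>, of the same order
as the noise accumulated by the weighted sum of the decreasing phase, and dividing by the final
weight, at least \<open>(a K / 2)\<^sup>2\<close>, yields the \<open>1 / K\<close> term. For \<open>K = 0\<close> the second summand of the bound is
zero by the convention for division by zero, and the first alone suffices.\<close>

lemma sseg_beta_recursion:
  fixes r :: "nat \<Rightarrow> real"
  assumes L: "0 < L" and mu: "0 < mu" "mu \<le> L" and c: "0 \<le> c" and r: "\<And>k. 0 \<le> r k"
    and a_def: "a = mu / (48 * L)"
    and step: "\<And>k. k < K \<Longrightarrow>
      r (Suc k) \<le> (1 - a * sseg_beta L mu K k) * r k + c * (sseg_beta L mu K k)\<^sup>2"
  shows "r K \<le> 32 / a * exp (- (a * real K / 2)) * r 0 + 36 * c / (a\<^sup>2 * real K)"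
proof -
  have a: "0 < a" "a \<le> 1 / 48" using L mu by (auto simp: a_def field_simps)
  have inv: "48 * L / mu = 1 / a" by (simp add: a_def)
  \<comment> \<open>The exponential term has ample room: a factor \<open>4\<close> is needed, whereas \<open>32 / a\<close> exceeds \<open>1000\<close>.\<close>
  have head: "y * r 0 \<le> 32 / a * exp (- (a * real K / 2)) * r 0"
    if "y \<le> 4 * exp (- (a * real K / 2))" for y
  proof -
    have "y \<le> 32 / a * exp (- (a * real K / 2))"
      using that a by (elim order_trans) (auto intro!: mult_right_mono simp: field_simps)
    then show ?thesis using r by (intro mult_right_mono) auto
  qed
  show ?thesis
  proof (cases "real K \<le> 1 / a")
    case True
    have "r (Suc k) \<le> (1 - a) * r k + c" if "k < K" for k
      using step[OF that] True by (simp add: sseg_beta_def inv)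
    from geometric_recursion[of a c r K, OF a(1) _ c r this] a
    have geo: "r K \<le> exp (- (a * real K)) * r 0 + c / a" by simp
    have expK: "exp (- (a * real K)) \<le> 4 * exp (- (a * real K / 2))"
      using a exp_le_cancel_iff[of "- (a * real K)" "- (a * real K / 2)"]
      by (smt (verit) exp_gt_zero mult_nonneg_nonneg of_nat_0_le_iff field_sum_of_halves)
    show ?thesis
    proof (cases "K = 0")
      case True
      then show ?thesis using head[of 1] by simp
    next
      case False
      have "c / a \<le> 36 * c / (a\<^sup>2 * real K)"
      proof -
        have "a * real K \<le> 1" using True a by (simp add: field_simps)
        then have "c * (a * real K) \<le> c * 36" using c by (intro mult_left_mono) auto
        then show ?thesis using a False by (simp add: field_simps power2_eq_square)
      qed
      with geo head[OF expK] show ?thesis by linarith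
    qed
  next
    case False
    define k0 where "k0 = nat \<lceil>real K / 2\<rceil>"
    have k0: "real K / 2 \<le> real k0" "real k0 < real K / 2 + 1" unfolding k0_def by linarith+
    have K1: "1 < a * real K" using False a by (simp add: field_simps)
    have K48: "real K > 48"
    proof (rule ccontr)
      assume "\<not> real K > 48"
      then have "a * real K \<le> 1 / 48 * 48" using a by (intro mult_mono) auto
      with K1 show False by simp
    qed
    then have k0K: "k0 \<le> K" using k0 by linarith
    define J where "J = K - k0"
    have J: "real J = real K - real k0" using k0K by (simp add: J_def)
    \<comment> \<open>Integrality sharpens \<open>2 k0 < K + 2\<close>.\<close>
    have "2 * k0 \<le> K + 1"
    proof -
      have "2 * real k0 < real K + 2" using k0 by simp
      then have "real (2 * k0) < real (K + 2)" by simp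
      then show ?thesis by linarith
    qed
    then have "2 * real k0 \<le> real K + 1" by linarith
    then have J2: "real J \<ge> (real K - 1) / 2" "real J \<le> real K / 2" using J k0 by auto
    have "r (Suc k) \<le> (1 - a) * r k + c" if "k < k0" for k
      using step[of k] that k0K False by (simp add: sseg_beta_def inv k0_def)
    from geometric_recursion[of a c r k0, OF a(1) _ c r this] a
    have "r k0 \<le> exp (- (a * real k0)) * r 0 + c / a" by simp
    also have "exp (- (a * real k0)) * r 0 \<le> exp (- (a * real K / 2)) * r 0"
      using k0 a r by (intro mult_right_mono) (auto simp: mult_left_mono)
    finally have rk0: "r k0 \<le> exp (- (a * real K / 2)) * r 0 + c / a" by simp
    have beta: "sseg_beta L mu K (k0 + j) = 2 / (2 + a * real j)" for j
    proof -
      have "sseg_beta L mu K (k0 + j) = 96 * L / (96 * L + mu * real j)"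
        using False by (simp add: sseg_beta_def inv k0_def Let_def)
      also have "96 * L + mu * real j = 48 * L * (2 + a * real j)"
        using L by (simp add: a_def field_simps)
      also have "96 * L / \<dots> = (48 * L * 2) / (48 * L * (2 + a * real j))" by simp
      also have "\<dots> = 2 / (2 + a * real j)"
        by (rule nonzero_mult_divide_mult_cancel_left) (use L in simp)
      finally show ?thesis .
    qed
    have "(2 + a * (real J - 1))\<^sup>2 * r (k0 + J) \<le> (2 - a)\<^sup>2 * r (k0 + 0) + 4 * c * real J"
      by (rule decreasing_recursion[where r = "\<lambda>j. r (k0 + j)"])
         (use a r step[of "k0 + j" for j] beta in \<open>auto simp: J_def\<close>)
    also have "k0 + J = K" using k0K by (simp add: J_def)
    finally have dec: "(2 + a * (real J - 1))\<^sup>2 * r K \<le> (2 - a)\<^sup>2 * r k0 + 4 * c * real J" by simp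
    have "(2 - a)\<^sup>2 * r k0 \<le> 4 * r k0"
      using a r power_mono[of "2 - a" 2 2] by (intro mult_right_mono) auto
    moreover have "4 * c * real J \<le> 4 * c * (real K / 2)"
      using c J2 by (intro mult_left_mono) auto
    moreover have "c / a \<le> c * real K" using mult_left_mono[OF less_imp_le[OF K1] c] a
      by (simp add: field_simps)
    ultimately have up: "(2 + a * (real J - 1))\<^sup>2 * r K
        \<le> 4 * (exp (- (a * real K / 2)) * r 0) + 6 * c * real K"
      using dec rk0 by linarith
    \<comment> \<open>The summand \<open>2\<close> in \<open>w\<close> compensates for the shift by one and for the rounding of \<open>K / 2\<close>.\<close>
    define w where "w = 2 + a * (real J - 1)"
    have "a * ((real K - 1) / 2) \<le> a * real J" using J2 a by (intro mult_left_mono) auto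
    then have w: "a * real K / 2 \<le> w" "1 \<le> w"
      using a K1 unfolding w_def by (auto simp: algebra_simps diff_divide_distrib)
    have w2: "1 \<le> w\<^sup>2" "(a * real K / 2)\<^sup>2 \<le> w\<^sup>2"
      using w a by (auto intro: power_mono simp: one_le_power)
    have "r K \<le> (4 * (exp (- (a * real K / 2)) * r 0) + 6 * c * real K) / w\<^sup>2"
      using up w by (simp add: w_def field_simps)
    also have "\<dots> = 4 * (exp (- (a * real K / 2)) * r 0) / w\<^sup>2 + 6 * c * real K / w\<^sup>2"
      by (simp add: add_divide_distrib)
    also have "4 * (exp (- (a * real K / 2)) * r 0) / w\<^sup>2 \<le> 4 * (exp (- (a * real K / 2)) * r 0) / 1"
      using w2 r w by (intro divide_left_mono) auto
    also have "6 * c * real K / w\<^sup>2 \<le> 6 * c * real K / (a * real K / 2)\<^sup>2"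
      using w2 w K1 a c K48 by (intro divide_left_mono) auto
    also have "\<dots> = 24 * c / (a\<^sup>2 * real K)" using a K48 by (simp add: field_simps power2_eq_square)
    also have "\<dots> \<le> 36 * c / (a\<^sup>2 * real K)" using c by (intro divide_right_mono) auto
    finally show ?thesis using head[of "4 * exp (- (a * real K / 2))"] by simp
  qed
qed

section \<open>Convergence of S-SEG under NICE sampling\<close>

theorem corollaryE5:
  fixes n b K :: nat
    and F :: "nat \<Rightarrow> real ^ 'd \<Rightarrow> real ^ 'd"
    and xs x0 :: "real ^ 'd"
    and L mu :: "nat \<Rightarrow> real"
    and LS muS :: "nat set \<Rightarrow> real"
    and M :: "'w measure"
    and \<xi> :: "nat \<Rightarrow> 'w \<Rightarrow> nat set"
    and Lm mb :: real
    and \<gamma>1 \<gamma>2 :: "nat \<Rightarrow> nat set \<Rightarrow> real"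
  assumes n: "n \<ge> 2" and b: "1 \<le> b" "b \<le> n"
    and root: "batch_op F {1..n} xs = 0"
    and lip: "\<And>i. i \<in> {1..n} \<Longrightarrow> (L i)-lipschitz_on UNIV (F i)"
    and mono: "\<And>i x. i \<in> {1..n} \<Longrightarrow> (F i x - F i xs) \<bullet> (x - xs) \<ge> mu i * (norm (x - xs))\<^sup>2"
    and LS_pos: "\<And>S. S \<in> batches n b \<Longrightarrow> LS S > 0"
    and LS_lip: "\<And>S. S \<in> batches n b \<Longrightarrow> (LS S)-lipschitz_on UNIV (batch_op F S)"
    and muS_ge: "\<And>S. S \<in> batches n b \<Longrightarrow> muS S \<ge> (1 / real b) * (\<Sum>i\<in>S. mu i)"
    and muS_LS: "\<And>S. S \<in> batches n b \<Longrightarrow> \<bar>muS S\<bar> \<le> LS S"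
    and muS_mono: "\<And>S x. S \<in> batches n b \<Longrightarrow>
        (batch_op F S x - batch_op F S xs) \<bullet> (x - xs) \<ge> muS S * (norm (x - xs))\<^sup>2"
    and mb_def: "mb = mu_bar_NICE n b muS" and mb_pos: "mb > 0"
    and Lm_def: "Lm = L_NICE n b LS"
    and prob: "prob_space M"
    and indep: "prob_space.indep_vars M (\<lambda>k. count_space (batches n b)) \<xi> UNIV"
    and unif: "\<And>k. distr M (count_space (batches n b)) (\<xi> k) = uniform_count_measure (batches n b)"
    and g1_def: "\<gamma>1 = (\<lambda>k S. sseg_beta Lm mb K k / (6 * Lm))"
    and g2_def: "\<gamma>2 = (\<lambda>k S. (1 / 4) * \<gamma>1 k S)"
  shows "(\<integral>\<omega>. (norm (S_SEG (batch_op F) \<gamma>1 \<gamma>2 x0 (\<lambda>k. \<xi> k \<omega>) K - xs))\<^sup>2 \<partial>M)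
    \<le> 1536 * Lm * (norm (x0 - xs))\<^sup>2 / mb * exp (- (mb * real K / (96 * Lm)))
      + 1728 * (real n - real b) * sigma2_US n F xs / (real b * (real n - 1) * mb\<^sup>2 * real K)"
proof -
  interpret prob_space M by (rule prob)
  let ?B = "batches n b"
  define V where "V = (real n - real b) * sigma2_US n F xs / (real b * (real n - 1))"
  define \<beta> where "\<beta> = sseg_beta Lm mb K"
  define r where "r = (\<lambda>k. expectation (\<lambda>\<omega>. (norm (S_SEG (batch_op F) \<gamma>1 \<gamma>2 x0 (\<lambda>k. \<xi> k \<omega>) k - xs))\<^sup>2))"
  have card: "0 < card ?B" using card_batches_pos[OF b(2)] .
  then have ne: "?B \<noteq> {}" by auto
  have LS_le: "LS S \<le> Lm" if "S \<in> ?B" for S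
    unfolding Lm_def L_NICE_def using that by (intro Max_ge) auto
  have Lm: "Lm > 0" using ne LS_pos LS_le by (metis ex_in_conv less_le_trans)
  have lipB: "Lm-lipschitz_on UNIV (batch_op F S)" if "S \<in> ?B" for S
    using LS_lip[OF that] LS_le[OF that] by (rule lipschitz_on_le)
  have muB: "\<bar>muS S\<bar> \<le> Lm" if "S \<in> ?B" for S
    using muS_LS[OF that] LS_le[OF that] by simp
  have mb: "mb = (\<Sum>S\<in>?B. eff_mu (muS S)) / real (card ?B)"
    unfolding mb_def by (rule mu_bar_NICE_eq_mean)
  have "(\<Sum>S\<in>?B. eff_mu (muS S)) \<le> (\<Sum>S\<in>?B. Lm)"
    using muB Lm by (intro sum_mono) (force simp: eff_mu_def)
  then have mb_le: "mb \<le> Lm" unfolding mb using card by (simp add: field_simps)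
  have zero: "(\<Sum>S\<in>?B. batch_op F S xs) = 0"
    using b n by (intro batch_op_mean_zero root) auto
  have V: "V = (\<Sum>S\<in>?B. (norm (batch_op F S xs))\<^sup>2) / real (card ?B)"
    unfolding V_def by (rule batch_op_variance[OF n b root, symmetric])
  have V0: "0 \<le> V" unfolding V by (intro divide_nonneg_nonneg sum_nonneg) auto
  define a where "a = mb / (48 * Lm)"
  define c where "c = V / (48 * Lm\<^sup>2)"
  have step: "r (Suc k) \<le> (1 - a * \<beta> k) * r k + c * (\<beta> k)\<^sup>2" for k
  proof -
    define \<gamma> where "\<gamma> = \<beta> k / (6 * Lm)"
    have \<beta>: "0 \<le> \<beta> k" "\<beta> k \<le> 1" using sseg_beta_bounds[OF Lm mb_pos] by (auto simp: \<beta>_def)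
    have \<gamma>: "0 \<le> \<gamma>" "\<gamma> * Lm \<le> 1 / 6" using \<beta> Lm by (auto simp: \<gamma>_def)
    have g: "\<gamma>1 k S = \<gamma>" "\<gamma>2 k S = \<gamma> / 4" for S by (auto simp: g1_def g2_def \<gamma>_def \<beta>_def)
    have "r (Suc k) \<le> (1 - \<gamma> / 4 * mb) * r k + 3 / 4 * \<gamma>\<^sup>2 * V"
      unfolding r_def
      by (rule expected_S_SEG_step[OF finite_batches indep unif], unfold g mb V,
          rule averaged_extragradient_step[OF finite_batches ne lipB muS_mono muB \<gamma> zero])
    \<comment> \<open>The contraction obtained is twice as strong as the rate \<open>a\<close> for which the stepsizes are tuned.\<close>
    also have "\<gamma> / 4 * mb = 2 * (a * \<beta> k)" using Lm by (simp add: \<gamma>_def a_def)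
    also have "3 / 4 * \<gamma>\<^sup>2 * V = c * (\<beta> k)\<^sup>2"
      using Lm by (simp add: \<gamma>_def c_def field_simps power2_eq_square)
    also have "(1 - 2 * (a * \<beta> k)) * r k \<le> (1 - a * \<beta> k) * r k"
    proof (rule mult_right_mono)
      have "0 \<le> a * \<beta> k" using \<beta> mb_pos Lm by (simp add: a_def)
      then show "1 - 2 * (a * \<beta> k) \<le> 1 - a * \<beta> k" by linarith
    qed (simp add: r_def)
    finally show ?thesis by simp
  qed
  have "r K \<le> 32 / a * exp (- (a * real K / 2)) * r 0 + 36 * c / (a\<^sup>2 * real K)"
  proof (rule sseg_beta_recursion[OF Lm mb_pos mb_le _ _ a_def])
    show "0 \<le> c" using V0 by (simp add: c_def)
    show "0 \<le> r k" for k by (simp add: r_def)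
    show "r (Suc k) \<le> (1 - a * sseg_beta Lm mb K k) * r k + c * (sseg_beta Lm mb K k)\<^sup>2" for k
      using step by (simp add: \<beta>_def)
  qed
  also have "r 0 = (norm (x0 - xs))\<^sup>2" by (simp add: r_def prob_space)
  also have "32 / a = 1536 * Lm / mb" by (simp add: a_def)
  also have "a * real K / 2 = mb * real K / (96 * Lm)" by (simp add: a_def)
  also have "36 * c / (a\<^sup>2 * real K) = 1728 * V / (mb\<^sup>2 * real K)"
    using Lm by (simp add: a_def c_def power2_eq_square field_simps)
  finally show ?thesis
    by (simp add: r_def V_def mult_ac)
qed

end
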